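(* Let $n,k\in\mathbb{Z}_+$. For each $\alpha\in(0,0.5]$ let a gain $K(\alpha)>0$ and positive numbers $z_i(\alpha),p_i(\alpha)$, $i=1,\dots,n$, be given, and for each $\alpha\in(0.5,1)$ let a gain $\bar K(\alpha)>0$ and positive numbers $\bar z_i(\alpha),\bar p_i(\alpha)$, $i=1,\dots,n$, be given. Define rational functions of the complex variable $s$ by $$\hat{\mathscr I}^{\alpha}(s)=\begin{cases}K(\alpha)\displaystyle\prod_{i=1}^n\Big(\frac{s+z_i(\alpha)}{s+p_i(\alpha)}\Big)^k, & 0<\alpha\le 0.5,\\[2ex] \dfrac{\bar K(\alpha)}{s}\displaystyle\prod_{i=1}^n\Big(\frac{s+\bar z_i(\alpha)}{s+\bar p_i(\alpha)}\Big)^k, & 0.5<\alpha<1,\end{cases}\qquad \hat{\mathscr D}^{\alpha}(s)=\frac{1}{\hat{\mathscr I}^{\alpha}(s)}.$$ Suppose that for every $\alpha\in(0.5,1)$ and every $i=1,\dots,n$, $$\bar p_i(\alpha)=z_i(1-\alpha),\qquad \bar z_i(\alpha)=p_i(1-\alpha),\qquad \bar K(\alpha)=K(1-\alpha)^{-1}.$$ Then the following identities of rational functions hold: (i) $\hat{\mathscr I}^{\alpha}(s)\,\hat{\mathscr I}^{1-\alpha}(s)=\dfrac1s$ for all $\alpha\in(0,0.5)\cup(0.5,1)$; (ii) $\hat{\mathscr D}^{\alpha}(s)\,\hat{\mathscr I}^{\alpha}(s)=1$ for all $\alpha\in(0,1)$; (iii) $\hat{\mathscr D}^{\alpha}(s)\,\hat{\mathscr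 D}^{1-\alpha}(s)=s$ for all $\alpha\in(0,0.5)\cup(0.5,1)$.
   Context: $\hat{\mathscr I}^\alpha(s)$ and $\hat{\mathscr D}^\alpha(s)$ are piecewise (in $\alpha$) rational approximate models for the fractional integrator $1/s^\alpha$ and the fractional differentiator $s^\alpha$; they are considered as rational functions of $s$ with real coefficients. $\mathbb{Z}_+$ denotes the positive integers. *)

theory Defs
  imports Complex_Main "HOL-Computational_Algebra.Polynomial" "HOL-Computational_Algebra.Fraction_Field"
begin

text \<open>Rational functions in \<open>s\<close> with real coefficients are elements of the field
  \<open>real poly fract\<close>, so identities below are identities in \<open>\<real>(s)\<close>, with no exceptional points.\<close>

type_synonym real_ratfun = "real poly fract"

definition rf_s :: real_ratfun where
  "rf_s = Fract [:0, 1:] 1"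

definition rf_const :: "real \<Rightarrow> real_ratfun" where
  "rf_const c = Fract [:c:] 1"

text \<open>The barred data of the source are \<open>Kb\<close>, \<open>zb\<close>, \<open>pb\<close>. The model is only meant for
  \<open>0 < \<alpha> < 1\<close>; outside this range the value is immaterial.\<close>

definition frac_integrator ::
  "nat \<Rightarrow> nat \<Rightarrow> (real \<Rightarrow> real) \<Rightarrow> (nat \<Rightarrow> real \<Rightarrow> real) \<Rightarrow> (nat \<Rightarrow> real \<Rightarrow> real)
    \<Rightarrow> (real \<Rightarrow> real) \<Rightarrow> (nat \<Rightarrow> real \<Rightarrow> real) \<Rightarrow> (nat \<Rightarrow> real \<Rightarrow> real) \<Rightarrow> real \<Rightarrow> real_ratfun"
where
  "frac_integrator n k K z p Kb zb pb \<alpha> =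
    (if \<alpha> \<le> 1/2
     then rf_const (K \<alpha>)
            * (\<Prod>i = 1..n. ((rf_s + rf_const (z i \<alpha>)) / (rf_s + rf_const (p i \<alpha>))) ^ k)
     else rf_const (Kb \<alpha>) / rf_s
            * (\<Prod>i = 1..n. ((rf_s + rf_const (zb i \<alpha>)) / (rf_s + rf_const (pb i \<alpha>))) ^ k))"

definition frac_differentiator ::
  "nat \<Rightarrow> nat \<Rightarrow> (real \<Rightarrow> real) \<Rightarrow> (nat \<Rightarrow> real \<Rightarrow> real) \<Rightarrow> (nat \<Rightarrow> real \<Rightarrow> real)
    \<Rightarrow> (real \<Rightarrow> real) \<Rightarrow> (nat \<Rightarrow> real \<Rightarrow> real) \<Rightarrow> (nat \<Rightarrow> real \<Rightarrow> real) \<Rightarrow> real \<Rightarrow> real_ratfun"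
where
  "frac_differentiator n k K z p Kb zb pb \<alpha> = 1 / frac_integrator n k K z p Kb zb pb \<alpha>"

end

theory Submission
  imports Defs
begin

text \<open>
  Passing from \<open>\<alpha> < 1/2\<close> to \<open>1 - \<alpha>\<close> swaps the zeros and poles and inverts the gain, so up to
  the extra integrator \<open>1/s\<close> the two models are reciprocal to each other
  (\<open>frac_integrator_reflect\<close>); for \<open>\<alpha> > 1/2\<close> the same identity is read with the two factors
  exchanged. The identities for the differentiator then only need that the integrator is a nonzero
  element of \<open>\<real>(s)\<close> (\<open>frac_integrator_nonzero\<close>): its gain is nonzero, and a linear factor
  \<open>s + c\<close> is a nonzero polynomial, which also justifies the cancellation of the factors.
\<close>

lemma rf_s_nonzero: "rf_s \<noteq> 0"
  by (simp add: rf_s_def Zero_fract_def eq_fract)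

lemma rf_const_eq_0_iff: "rf_const c = 0 \<longleftrightarrow> c = 0"
  by (simp add: rf_const_def Zero_fract_def eq_fract)

lemma rf_const_mult: "rf_const a * rf_const b = rf_const (a * b)"
  by (simp add: rf_const_def mult.commute)

lemma rf_const_1: "rf_const 1 = 1"
  by (simp add: rf_const_def One_fract_def one_pCons)

lemma rf_s_add_const_nonzero: "rf_s + rf_const c \<noteq> 0"
  by (simp add: rf_s_def rf_const_def Zero_fract_def eq_fract)

lemma frac_integrator_nonzero:
  assumes "\<alpha> \<le> 1/2 \<Longrightarrow> K \<alpha> \<noteq> 0" and "\<alpha> > 1/2 \<Longrightarrow> Kb \<alpha> \<noteq> 0"
  shows "frac_integrator n k K z p Kb zb pb \<alpha> \<noteq> 0"
  using assms
  by (simp add: frac_integrator_def rf_s_nonzero rf_const_eq_0_iff rf_s_add_const_nonzero)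

lemma frac_integrator_reflect:
  assumes "\<alpha> < 1/2" and "K \<alpha> \<noteq> 0"
    and "\<And>i. i \<in> {1..n} \<Longrightarrow> pb i (1 - \<alpha>) = z i \<alpha>"
    and "\<And>i. i \<in> {1..n} \<Longrightarrow> zb i (1 - \<alpha>) = p i \<alpha>"
    and "Kb (1 - \<alpha>) = inverse (K \<alpha>)"
  shows "frac_integrator n k K z p Kb zb pb \<alpha> * frac_integrator n k K z p Kb zb pb (1 - \<alpha>)
    = 1 / rf_s"
proof -
  let ?P = "\<Prod>i = 1..n. ((rf_s + rf_const (z i \<alpha>)) / (rf_s + rf_const (p i \<alpha>))) ^ k"
  let ?Q = "\<Prod>i = 1..n. ((rf_s + rf_const (zb i (1 - \<alpha>))) / (rf_s + rf_const (pb i (1 - \<alpha>)))) ^ k"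
  have "?P * ?Q = (\<Prod>i = 1..n. 1)"
    unfolding prod.distrib [symmetric]
    by (rule prod.cong) (simp_all add: assms rf_s_add_const_nonzero flip: power_mult_distrib)
  then have zeros_poles: "?P * ?Q = 1"
    by simp
  have gain: "rf_const (K \<alpha>) * rf_const (Kb (1 - \<alpha>)) = 1"
    using assms by (simp add: rf_const_mult rf_const_1)
  have "frac_integrator n k K z p Kb zb pb \<alpha> * frac_integrator n k K z p Kb zb pb (1 - \<alpha>)
    = (rf_const (K \<alpha>) * ?P) * (rf_const (Kb (1 - \<alpha>)) / rf_s * ?Q)"
    using assms(1) by (simp add: frac_integrator_def)
  also have "\<dots> = (rf_const (K \<alpha>) * rf_const (Kb (1 - \<alpha>))) * (?P * ?Q) / rf_s"
    by (simp only: times_divide_eq_left times_divide_eq_right mult_ac)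
  finally show ?thesis
    by (simp only: gain zeros_poles mult_1)
qed

theorem mainTheorem1:
  fixes n k :: nat
    and K Kb :: "real \<Rightarrow> real"
    and z p zb pb :: "nat \<Rightarrow> real \<Rightarrow> real"
  defines "I \<equiv> frac_integrator n k K z p Kb zb pb"
    and "D \<equiv> frac_differentiator n k K z p Kb zb pb"
  assumes "n \<ge> 1" and "k \<ge> 1"
    and "\<And>\<alpha>. \<alpha> \<in> {0<..1/2} \<Longrightarrow> K \<alpha> > 0"
    and "\<And>\<alpha> i. \<alpha> \<in> {0<..1/2} \<Longrightarrow> i \<in> {1..n} \<Longrightarrow> z i \<alpha> > 0 \<and> p i \<alpha> > 0"
    and "\<And>\<alpha>. \<alpha> \<in> {1/2<..<1} \<Longrightarrow> Kb \<alpha> > 0"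
    and "\<And>\<alpha> i. \<alpha> \<in> {1/2<..<1} \<Longrightarrow> i \<in> {1..n} \<Longrightarrow> zb i \<alpha> > 0 \<and> pb i \<alpha> > 0"
    and "\<And>\<alpha> i. \<alpha> \<in> {1/2<..<1} \<Longrightarrow> i \<in> {1..n} \<Longrightarrow> pb i \<alpha> = z i (1 - \<alpha>)"
    and "\<And>\<alpha> i. \<alpha> \<in> {1/2<..<1} \<Longrightarrow> i \<in> {1..n} \<Longrightarrow> zb i \<alpha> = p i (1 - \<alpha>)"
    and "\<And>\<alpha>. \<alpha> \<in> {1/2<..<1} \<Longrightarrow> Kb \<alpha> = inverse (K (1 - \<alpha>))"
  shows "(\<forall>\<alpha> \<in> {0<..<1/2} \<union> {1/2<..<1}. I \<alpha> * I (1 - \<alpha>) = 1 / rf_s)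
       \<and> (\<forall>\<alpha> \<in> {0<..<1}. D \<alpha> * I \<alpha> = 1)
       \<and> (\<forall>\<alpha> \<in> {0<..<1/2} \<union> {1/2<..<1}. D \<alpha> * D (1 - \<alpha>) = rf_s)"
proof -
  have nz: "I \<alpha> \<noteq> 0" if "\<alpha> \<in> {0<..<1}" for \<alpha>
    unfolding I_def using that assms(5)[of \<alpha>] assms(7)[of \<alpha>]
    by (intro frac_integrator_nonzero) auto
  have low: "I \<alpha> * I (1 - \<alpha>) = 1 / rf_s" if "\<alpha> \<in> {0<..<1/2}" for \<alpha>
    unfolding I_def
    using that assms(5)[of \<alpha>] assms(9)[of "1 - \<alpha>"] assms(10)[of "1 - \<alpha>"] assms(11)[of "1 - \<alpha>"]
    by (intro frac_integrator_reflect) auto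
  have I_reflect: "I \<alpha> * I (1 - \<alpha>) = 1 / rf_s" if "\<alpha> \<in> {0<..<1/2} \<union> {1/2<..<1}" for \<alpha>
    using that low[of \<alpha>] low[of "1 - \<alpha>"] by (auto simp: mult.commute)
  have D_eq: "D \<alpha> = 1 / I \<alpha>" for \<alpha>
    by (simp add: D_def I_def frac_differentiator_def)
  have "D \<alpha> * D (1 - \<alpha>) = rf_s" if "\<alpha> \<in> {0<..<1/2} \<union> {1/2<..<1}" for \<alpha>
  proof -
    have "D \<alpha> * D (1 - \<alpha>) = 1 / (I \<alpha> * I (1 - \<alpha>))"
      by (simp add: D_eq)
    also have "\<dots> = rf_s"
      by (simp add: I_reflect[OF that])
    finally show ?thesis .
  qed
  with I_reflect nz show ?thesis
    by (simp add: D_eq)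
qed

end
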